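(* Let $S$ be a semigroup with involution $\mathfrak{I}$ and let $\sigma:S\times S\to\mathbb{C}$ satisfy the $2$-cocycle property $\sigma(a,b)\sigma(ab,c)=\sigma(a,bc)\sigma(b,c)$ for all $a,b,c\in S$. Let $U$ be a symmetric projective representation of $S$ (with respect to $\sigma$) on the Kreĭn space $\mathcal{K}$. Then the following assertions are equivalent: (1) $U$ is similar to a symmetric projective representation $T$ (with respect to $\sigma$) on a Hilbert space. (2) $U$ is fundamentally reducible.
   Context: A Kreĭn space is an indefinite inner product space $(\mathcal{K},[\cdot,\cdot])$ for which there is a positive inner product $\langle\cdot,\cdot\rangle$ turning $\mathcal{K}$ into a Hilbert space, and an operator $J=J^*=J^{-1}$ on $\mathcal{K}$ (a fundamental symmetry) with $[\xi,\eta]=\langle J\xi,\eta\rangle$. $\mathcal{L}(\mathcal{K})$ is the set of bounded linear operators on $\mathcal{K}$ and $T^\sharp$ the adjoint with respect to $[\cdot,\cdot]$ (the usual adjoint if the space is a Hilbert space). An involution on $S$ is a map $\mathfrak{I}:S\to S$ with $\mathfrak{I}(\mathfrak{I}(a))=a$ and $\mathfrak{I}(ab)=\mathfrak{I}(b)\mathfrak{I}(a)$. A projective representation of $S$ on $\mathcal{K}$ is a map $U:S\to\mathcal{L}(\mathcal{K})$ with $U(a)U(b)=\sigma(a,b)U(ab)$ for all $a,b\in S$; it is symmetric if $U(a)^\sharp=\overline{\sigma(\mathfrak{I}(a),a)}\,U(\mathfrak{I}(a))$ for all $a\in S$. $U$ on $\mathcal{K}$ is similar to $T$ on $\mathcal{G}$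 if there is a bounded, boundedly invertible operator $\Phi\in\mathcal{L}(\mathcal{K},\mathcal{G})$ with $T(a)\Phi=\Phi U(a)$ for all $a\in S$. $U$ is fundamentally reducible if there exists a fundamental symmetry $J$ on $\mathcal{K}$ such that $U(a)J=JU(a)$ for all $a\in S$. *)

theory Defs
  imports "HOL-Analysis.Analysis"
begin

text \<open>
  Complex vector spaces are given by an explicit scalar multiplication on a type of class
  \<^class>\<open>ab_group_add\<close>, as in \<^locale>\<open>vector_space\<close>. Forms are linear in the first and
  conjugate-linear in the second argument.
\<close>

locale hermitian_space = vector_space smul
  for smul :: "complex \<Rightarrow> 'k::ab_group_add \<Rightarrow> 'k" +
  fixes form :: "'k \<Rightarrow> 'k \<Rightarrow> complex"
  assumes form_add_left: "form (x + y) z = form x z + form y z"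
    and form_smul_left: "form (smul c x) y = c * form x y"
    and form_hermitian: "form y x = cnj (form x y)"

definition form_norm :: "('k::ab_group_add \<Rightarrow> 'k \<Rightarrow> complex) \<Rightarrow> 'k \<Rightarrow> real" where
  "form_norm ip x = sqrt (Re (ip x x))"

locale hilbert_space = hermitian_space smul ip
  for smul :: "complex \<Rightarrow> 'k::ab_group_add \<Rightarrow> 'k" and ip :: "'k \<Rightarrow> 'k \<Rightarrow> complex" +
  assumes ip_pos: "x \<noteq> 0 \<Longrightarrow> 0 < Re (ip x x)"
    and complete: "Metric_space.mcomplete UNIV (\<lambda>x y. form_norm ip (x - y))"

definition fundamental_pair ::
  "(complex \<Rightarrow> 'k::ab_group_add \<Rightarrow> 'k) \<Rightarrow> ('k \<Rightarrow> 'k \<Rightarrow> complex) \<Rightarrow>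
   ('k \<Rightarrow> 'k \<Rightarrow> complex) \<Rightarrow> ('k \<Rightarrow> 'k) \<Rightarrow> bool" where
  "fundamental_pair smul form ip J \<longleftrightarrow>
     hilbert_space smul ip \<and>
     Vector_Spaces.linear smul smul J \<and>
     (\<forall>x y. ip (J x) y = ip x (J y)) \<and>
     (\<forall>x. J (J x) = x) \<and>
     (\<forall>x y. form x y = ip (J x) y)"

definition fundamental_symmetry ::
  "(complex \<Rightarrow> 'k::ab_group_add \<Rightarrow> 'k) \<Rightarrow> ('k \<Rightarrow> 'k \<Rightarrow> complex) \<Rightarrow> ('k \<Rightarrow> 'k) \<Rightarrow> bool" where
  "fundamental_symmetry smul form J \<longleftrightarrow> (\<exists>ip. fundamental_pair smul form ip J)"

text \<open>As usual, ``indefinite'' means ``not necessarily definite'': Hilbert spaces are included.\<close>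

locale krein_space = hermitian_space smul form
  for smul :: "complex \<Rightarrow> 'k::ab_group_add \<Rightarrow> 'k" and form :: "'k \<Rightarrow> 'k \<Rightarrow> complex" +
  assumes ex_fundamental_symmetry: "\<exists>J. fundamental_symmetry smul form J"

text \<open>
  The topology of a Krein space is that of any Hilbert space inner product as in
  \<^const>\<open>fundamental_pair\<close>. All the resulting norms are equivalent, so it does not matter
  which of them are taken in the following definition. On a Hilbert space only its own norm
  occurs, see \<open>hilbert_space.fundamental_pair_unique\<close> below.
\<close>

definition bounded_operator ::
  "(complex \<Rightarrow> 'k::ab_group_add \<Rightarrow> 'k) \<Rightarrow> ('k \<Rightarrow> 'k \<Rightarrow> complex) \<Rightarrow>
   (complex \<Rightarrow> 'g::ab_group_add \<Rightarrow> 'g) \<Rightarrow> ('g \<Rightarrow> 'g \<Rightarrow> complex) \<Rightarrow> ('k \<Rightarrow> 'g) \<Rightarrow> bool" where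
  "bounded_operator smulK formK smulG formG A \<longleftrightarrow>
     Vector_Spaces.linear smulK smulG A \<and>
     (\<exists>ipK JK ipG JG. fundamental_pair smulK formK ipK JK \<and> fundamental_pair smulG formG ipG JG \<and>
        (\<exists>C. \<forall>x. form_norm ipG (A x) \<le> C * form_norm ipK x))"

definition is_form_adjoint ::
  "('k \<Rightarrow> 'k \<Rightarrow> complex) \<Rightarrow> ('k \<Rightarrow> 'k) \<Rightarrow> ('k \<Rightarrow> 'k) \<Rightarrow> bool" where
  "is_form_adjoint form A B \<longleftrightarrow> (\<forall>x y. form (A x) y = form x (B y))"

definition semigroup_involution :: "('s::semigroup_mult \<Rightarrow> 's) \<Rightarrow> bool" where
  "semigroup_involution \<II> \<longleftrightarrow> (\<forall>a. \<II> (\<II> a) = a) \<and> (\<forall>a b. \<II> (a * b) = \<II> b * \<II> a)"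

definition two_cocycle :: "('s::semigroup_mult \<Rightarrow> 's \<Rightarrow> complex) \<Rightarrow> bool" where
  "two_cocycle \<sigma> \<longleftrightarrow> (\<forall>a b c. \<sigma> a b * \<sigma> (a * b) c = \<sigma> a (b * c) * \<sigma> b c)"

definition projective_rep ::
  "('s::semigroup_mult \<Rightarrow> 's \<Rightarrow> complex) \<Rightarrow>
   (complex \<Rightarrow> 'k::ab_group_add \<Rightarrow> 'k) \<Rightarrow> ('k \<Rightarrow> 'k \<Rightarrow> complex) \<Rightarrow> ('s \<Rightarrow> 'k \<Rightarrow> 'k) \<Rightarrow> bool" where
  "projective_rep \<sigma> smul form U \<longleftrightarrow>
     (\<forall>a. bounded_operator smul form smul form (U a)) \<and>
     (\<forall>a b x. U a (U b x) = smul (\<sigma> a b) (U (a * b) x))"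

definition symmetric_projective_rep ::
  "('s::semigroup_mult \<Rightarrow> 's) \<Rightarrow> ('s \<Rightarrow> 's \<Rightarrow> complex) \<Rightarrow>
   (complex \<Rightarrow> 'k::ab_group_add \<Rightarrow> 'k) \<Rightarrow> ('k \<Rightarrow> 'k \<Rightarrow> complex) \<Rightarrow> ('s \<Rightarrow> 'k \<Rightarrow> 'k) \<Rightarrow> bool" where
  "symmetric_projective_rep \<II> \<sigma> smul form U \<longleftrightarrow>
     projective_rep \<sigma> smul form U \<and>
     (\<forall>a. is_form_adjoint form (U a) (\<lambda>x. smul (cnj (\<sigma> (\<II> a) a)) (U (\<II> a) x)))"

definition similar_reps ::
  "(complex \<Rightarrow> 'k::ab_group_add \<Rightarrow> 'k) \<Rightarrow> ('k \<Rightarrow> 'k \<Rightarrow> complex) \<Rightarrow> ('s \<Rightarrow> 'k \<Rightarrow> 'k) \<Rightarrow>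
   (complex \<Rightarrow> 'g::ab_group_add \<Rightarrow> 'g) \<Rightarrow> ('g \<Rightarrow> 'g \<Rightarrow> complex) \<Rightarrow> ('s \<Rightarrow> 'g \<Rightarrow> 'g) \<Rightarrow> bool" where
  "similar_reps smulK formK U smulG formG T \<longleftrightarrow>
     (\<exists>\<Phi>. bounded_operator smulK formK smulG formG \<Phi> \<and> bij \<Phi> \<and>
          bounded_operator smulG formG smulK formK (inv \<Phi>) \<and>
          (\<forall>a. T a \<circ> \<Phi> = \<Phi> \<circ> U a))"

text \<open>
  The Hilbert space here lives on the type \<open>'g\<close>, since HOL cannot quantify over types
  inside a formula.
\<close>

definition similar_to_hilbert_rep ::
  "'g::ab_group_add itself \<Rightarrow> ('s::semigroup_mult \<Rightarrow> 's) \<Rightarrow> ('s \<Rightarrow> 's \<Rightarrow> complex) \<Rightarrow>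
   (complex \<Rightarrow> 'k::ab_group_add \<Rightarrow> 'k) \<Rightarrow> ('k \<Rightarrow> 'k \<Rightarrow> complex) \<Rightarrow> ('s \<Rightarrow> 'k \<Rightarrow> 'k) \<Rightarrow> bool" where
  "similar_to_hilbert_rep TYPE('g) \<II> \<sigma> smul form U \<longleftrightarrow>
     (\<exists>(smulG :: complex \<Rightarrow> 'g \<Rightarrow> 'g) ipG T.
        hilbert_space smulG ipG \<and>
        symmetric_projective_rep \<II> \<sigma> smulG ipG T \<and>
        similar_reps smul form U smulG ipG T)"

definition fundamentally_reducible ::
  "(complex \<Rightarrow> 'k::ab_group_add \<Rightarrow> 'k) \<Rightarrow> ('k \<Rightarrow> 'k \<Rightarrow> complex) \<Rightarrow> ('s \<Rightarrow> 'k \<Rightarrow> 'k) \<Rightarrow> bool" where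
  "fundamentally_reducible smul form U \<longleftrightarrow>
     (\<exists>J. fundamental_symmetry smul form J \<and> (\<forall>a. U a \<circ> J = J \<circ> U a))"


lemma (in hilbert_space) fundamental_pair_id: "fundamental_pair smul ip ip id"
  unfolding fundamental_pair_def
  using hilbert_space_axioms linear_id by auto

lemma (in hilbert_space) krein_space: "krein_space smul ip"
  by unfold_locales (auto simp: fundamental_symmetry_def intro: fundamental_pair_id)

lemma (in hilbert_space) fundamental_pair_unique:
  assumes "fundamental_pair smul ip ip' J"
  shows "ip' = ip" "J = id"
proof -
  interpret H: hilbert_space smul ip'
    using assms by (simp add: fundamental_pair_def)
  interpret L: Vector_Spaces.linear smul smul J
    using assms by (simp add: fundamental_pair_def)
  have JJ: "J (J x) = x" and eq: "ip x y = ip' (J x) y" for x y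
    using assms by (auto simp: fundamental_pair_def)
  have neg: "ip' (- x) y = - ip' x y" for x y
    using H.form_smul_left[of "-1" x y] by simp
  have fix_J: "J x = x" for x
  proof (rule ccontr)
    assume "J x \<noteq> x"
    then have nz: "x - J x \<noteq> 0" by simp
    have "J (x - J x) = - (x - J x)"
      by (simp add: L.diff JJ)
    then have "ip (x - J x) (x - J x) = - ip' (x - J x) (x - J x)"
      by (simp only: eq neg)
    with ip_pos[OF nz] H.ip_pos[OF nz] show False by simp
  qed
  then show "J = id" by auto
  show "ip' = ip" by (intro ext) (simp add: eq fix_J)
qed

lemma (in krein_space) form_adjoint_unique:
  assumes "is_form_adjoint form A B" "is_form_adjoint form A B'"
  shows "B = B'"
proof
  fix y
  obtain ip J where p: "fundamental_pair smul form ip J"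
    using ex_fundamental_symmetry by (auto simp: fundamental_symmetry_def)
  interpret H: hilbert_space smul ip
    using p by (simp add: fundamental_pair_def)
  have eq: "ip x y = form (J x) y" for x y
    using p by (simp add: fundamental_pair_def)
  define z where "z = B y - B' y"
  have "ip x (B y) = ip x (B' y)" for x
    using assms by (simp add: eq is_form_adjoint_def)
  then have "ip (B y) x = ip (B' y) x" for x
    by (metis H.form_hermitian)
  moreover have "ip (B y) z = ip z z + ip (B' y) z"
    using H.form_add_left[of z "B' y" z] by (simp add: z_def)
  ultimately have "ip z z = 0" by simp
  then have "z = 0" using H.ip_pos[of z] by force
  then show "B y = B' y" by (simp add: z_def)
qed

end

theory Submission
  imports Defs
begin

text \<open>
  If a fundamental symmetry \<open>J\<close> commutes with \<open>U\<close>, then \<open>U\<close> itself is symmetric for the inner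
  product \<open>form (J x) y\<close>, and the similarity is the identity. Conversely, a similarity to a
  Hilbert space representation pulls back to an equivalent inner product \<open>ip'\<close> for which \<open>U a\<close> has
  the same adjoint as for the Krein form. The Gram operator \<open>A\<close> in \<open>form x y = ip' (A x) y\<close>
  then commutes with \<open>U\<close>, and so does its sign \<open>A\<^sup>-\<^sup>1 |A|\<close>, which is a fundamental symmetry.
\<close>

subsection \<open>Inner products and completeness\<close>

text \<open>Boundedness in \<open>bounded_operator\<close> is witnessed by some choice of Hilbert
  inner products, so a similarity and its inverse may be controlled by different norms on the Krein
  space. A two-sided bound for the pulled back norm therefore needs all these norms to be
  equivalent; this is where Baire enters. With respect to \<open>ip'\<close> the operator
  \<open>A\<close> is selfadjoint and invertible, but in general not an involution; dividing by
  \<open>|A|\<close> repairs this. The operator \<open>|A|\<close> is a strong limit of polynomials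
  in the square of \<open>A\<close>, so every operator that has an adjoint and commutes with
  \<open>A\<close> commutes with \<open>|A|\<close>. The inverse of \<open>A\<close> is obtained by
  exchanging roles: it is the Gram operator of \<open>ip'\<close> relative to
  \<open>form\<close>.\<close>

context hermitian_space
begin

lemma form_add_right: "form x (y + z) = form x y + form x z"
  by (metis form_add_left form_hermitian complex_cnj_add)

lemma form_smul_right: "form x (smul c y) = cnj c * form x y"
  by (metis form_smul_left form_hermitian complex_cnj_mult)

lemma form_zero_left [simp]: "form 0 x = 0"
  using form_add_left[of 0 0 x] by simp

lemma form_zero_right [simp]: "form x 0 = 0"
  using form_add_right[of x 0 0] by simp

lemma form_uminus_left [simp]: "form (- x) y = - form x y"
  using form_add_left[of x "- x" y] by (simp add: add_eq_0_iff)

lemma form_uminus_right [simp]: "form x (- y) = - form x y"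
  using form_add_right[of x y "- y"] by (simp add: add_eq_0_iff)

lemma form_diff_left: "form (x - y) z = form x z - form y z"
  using form_add_left[of x "- y" z] by simp

lemma form_diff_right: "form x (y - z) = form x y - form x z"
  using form_add_right[of x y "- z"] by simp

lemmas form_simps = form_add_left form_add_right form_smul_left form_smul_right
  form_diff_left form_diff_right

lemma form_self_real: "form x x = of_real (Re (form x x))"
  using form_hermitian[of x x] by (simp add: complex_eq_iff)

lemma Re_form_commute: "Re (form y x) = Re (form x y)"
  by (subst form_hermitian) simp

lemma linear_iff:
  "Vector_Spaces.linear smul smul A \<longleftrightarrow>
     (\<forall>x y. A (x + y) = A x + A y) \<and> (\<forall>c x. A (smul c x) = smul c (A x))"
  using vector_space_axioms
  by (auto simp: Vector_Spaces.linear_def module_hom_def module_hom_axioms_def module_iff_vector_space)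

end

text \<open>Completeness is split off so that a new inner product already has a norm and a metric
  while its completeness is still to be proved.\<close>

locale pre_hilbert_space = hermitian_space smul ip
  for smul :: "complex \<Rightarrow> 'k::ab_group_add \<Rightarrow> 'k" and ip :: "'k \<Rightarrow> 'k \<Rightarrow> complex" +
  assumes ip_pos: "x \<noteq> 0 \<Longrightarrow> 0 < Re (ip x x)"
begin

abbreviation N :: "'k \<Rightarrow> real" where "N \<equiv> form_norm ip"

lemma Re_ip_nonneg: "0 \<le> Re (ip x x)"
  using ip_pos[of x] by (cases "x = 0") auto

lemma N_nonneg [simp]: "0 \<le> N x"
  by (simp add: form_norm_def Re_ip_nonneg)

lemma N_sq: "(N x)\<^sup>2 = Re (ip x x)"
  by (simp add: form_norm_def Re_ip_nonneg)

lemma ip_self: "ip x x = of_real ((N x)\<^sup>2)"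
  using form_self_real[of x] by (simp add: N_sq)

lemma N_eq_0 [simp]: "N x = 0 \<longleftrightarrow> x = 0"
  using ip_pos[of x] by (cases "x = 0") (auto simp: form_norm_def)

lemma N_zero [simp]: "N 0 = 0"
  by (simp only: N_eq_0)

lemma ip_ext: "(\<And>z. ip x z = ip y z) \<Longrightarrow> x = y"
  using ip_pos[of "x - y"] by (force simp: form_diff_left)

lemma N_smul: "N (smul c x) = cmod c * N x"
proof -
  have "ip (smul c x) (smul c x) = c * cnj c * ip x x"
    by (simp add: form_smul_left form_smul_right)
  also have "\<dots> = of_real ((cmod c)\<^sup>2 * (N x)\<^sup>2)"
    by (simp only: complex_norm_square ip_self of_real_mult)
  finally have "ip (smul c x) (smul c x) = of_real ((cmod c)\<^sup>2 * (N x)\<^sup>2)" .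
  then have "(N (smul c x))\<^sup>2 = (cmod c * N x)\<^sup>2"
    by (simp only: N_sq Re_complex_of_real power_mult_distrib)
  then show ?thesis
    by (rule power2_eq_imp_eq) auto
qed

lemma N_uminus [simp]: "N (- x) = N x"
  by (simp add: form_norm_def)

lemma N_minus_commute: "N (x - y) = N (y - x)"
  by (metis N_uminus minus_diff_eq)

lemma N_add_sq: "(N (x + y))\<^sup>2 = (N x)\<^sup>2 + 2 * Re (ip x y) + (N y)\<^sup>2"
  using Re_form_commute[of x y] by (simp add: N_sq form_simps)

lemma N_diff_sq: "(N (x - y))\<^sup>2 = (N x)\<^sup>2 - 2 * Re (ip x y) + (N y)\<^sup>2"
  using Re_form_commute[of x y] by (simp add: N_sq form_simps)

lemma Cauchy_Schwarz: "cmod (ip x y) \<le> N x * N y"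
proof (cases "y = 0")
  case False
  define c where "c = ip x y / of_real ((N y)\<^sup>2)"
  have pos: "(N y)\<^sup>2 > 0" using False by simp
  have "ip (x - smul c y) y = 0"
    using pos by (simp add: form_simps ip_self c_def)
  then have "ip (x - smul c y) (x - smul c y) = ip x x - c * ip y x"
    by (simp only: form_diff_right form_smul_right) (simp add: form_simps)
  moreover have "c * ip y x = of_real ((cmod (ip x y))\<^sup>2 / (N y)\<^sup>2)"
    by (simp only: form_hermitian[of y x] c_def of_real_divide complex_norm_square times_divide_eq_left)
  ultimately have "(N (x - smul c y))\<^sup>2 = (N x)\<^sup>2 - (cmod (ip x y))\<^sup>2 / (N y)\<^sup>2"
    by (simp only: N_sq minus_complex.sel Re_complex_of_real)
  then have "(cmod (ip x y))\<^sup>2 / (N y)\<^sup>2 \<le> (N x)\<^sup>2"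
    by (metis diff_ge_0_iff_ge zero_le_power2)
  then have "(cmod (ip x y))\<^sup>2 \<le> (N x * N y)\<^sup>2"
    using pos by (simp add: pos_divide_le_eq power_mult_distrib)
  then show ?thesis
    by (rule power2_le_imp_le) simp
qed simp

lemma N_triangle: "N (x + y) \<le> N x + N y"
proof (rule power2_le_imp_le)
  have "Re (ip x y) \<le> N x * N y"
    using Cauchy_Schwarz complex_Re_le_cmod order_trans by blast
  then show "(N (x + y))\<^sup>2 \<le> (N x + N y)\<^sup>2"
    by (simp add: N_add_sq power2_sum)
qed simp

lemma N_triangle_diff: "N (x - z) \<le> N (x - y) + N (y - z)"
  using N_triangle[of "x - y" "y - z"] by simp

lemma parallelogram: "(N (x - y))\<^sup>2 = 2 * (N x)\<^sup>2 + 2 * (N y)\<^sup>2 - (N (x + y))\<^sup>2"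
  by (simp add: N_add_sq N_diff_sq)

sublocale metric: Metric_space UNIV "\<lambda>x y. N (x - y)"
proof
  show "N (x - y) = N (y - x)" "N (x - z) \<le> N (x - y) + N (y - z)" for x y z
    by (fact N_minus_commute N_triangle_diff)+
qed auto

lemma ip_tendsto_left:
  assumes "(\<lambda>n. N (X n - l)) \<longlonglongrightarrow> 0"
  shows "(\<lambda>n. ip (X n) y) \<longlonglongrightarrow> ip l y"
proof (rule LIM_zero_cancel, rule Lim_null_comparison)
  show "\<forall>\<^sub>F n in sequentially. cmod (ip (X n) y - ip l y) \<le> N (X n - l) * N y"
    using Cauchy_Schwarz by (simp flip: form_diff_left)
  show "(\<lambda>n. N (X n - l) * N y) \<longlonglongrightarrow> 0"
    using tendsto_mult_right[OF assms, of "N y"] by simp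
qed

lemma ip_tendsto_right:
  assumes "(\<lambda>n. N (X n - l)) \<longlonglongrightarrow> 0"
  shows "(\<lambda>n. ip y (X n)) \<longlonglongrightarrow> ip y l"
  using tendsto_cnj[OF ip_tendsto_left[OF assms, of y]] by (simp flip: form_hermitian)

lemma limitin_iff: "limitin metric.mtopology X l sequentially \<longleftrightarrow> (\<lambda>n. N (X n - l)) \<longlonglongrightarrow> 0"
  by (simp add: metric.limitin_metric_dist_null)

lemma mcomplete_iff:
  "metric.mcomplete \<longleftrightarrow>
     (\<forall>X. (\<forall>e>0. \<exists>M. \<forall>m\<ge>M. \<forall>n\<ge>M. N (X m - X n) < e) \<longrightarrow> (\<exists>l. (\<lambda>n. N (X n - l)) \<longlonglongrightarrow> 0))"
  unfolding metric.mcomplete_def metric.MCauchy_def limitin_iff by auto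

end

sublocale hilbert_space \<subseteq> pre_hilbert_space
  by unfold_locales (rule ip_pos)

lemma (in pre_hilbert_space) hilbert_spaceI:
  assumes "metric.mcomplete"
  shows "hilbert_space smul ip"
  by unfold_locales (use ip_pos assms in auto)

lemma (in hilbert_space) Cauchy_converges:
  assumes "\<And>e. e > 0 \<Longrightarrow> \<exists>M. \<forall>m\<ge>M. \<forall>n\<ge>M. N (X m - X n) < e"
  shows "\<exists>l. (\<lambda>n. N (X n - l)) \<longlonglongrightarrow> 0"
  using complete assms by (auto simp: mcomplete_iff)

text \<open>The lower bound gives positivity and turns Cauchy sequences for \<open>b\<close> into
  Cauchy sequences for \<open>ip\<close>; the upper bound carries the limit back.\<close>

lemma (in hilbert_space) equivalent_hilbert_space:
  assumes "hermitian_space smul b" and "c > 0"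
    and lower: "\<And>x. c * N x \<le> form_norm b x" and upper: "\<And>x. form_norm b x \<le> C * N x"
  shows "hilbert_space smul b"
proof -
  interpret b: hermitian_space smul b by fact
  interpret b: pre_hilbert_space smul b
  proof
    fix x :: 'k assume "x \<noteq> 0"
    then have "0 < c * N x"
      using \<open>c > 0\<close> by (simp add: less_le)
    also note lower
    finally show "0 < Re (b x x)"
      by (simp add: form_norm_def)
  qed
  have "b.metric.mcomplete"
    unfolding b.mcomplete_iff
  proof (intro allI impI)
    fix X :: "nat \<Rightarrow> 'k" assume X: "\<forall>e>0. \<exists>M. \<forall>m\<ge>M. \<forall>n\<ge>M. form_norm b (X m - X n) < e"
    have "\<exists>l. (\<lambda>n. N (X n - l)) \<longlonglongrightarrow> 0"
    proof (rule Cauchy_converges)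
      fix e :: real assume "e > 0"
      then obtain M where "\<forall>m\<ge>M. \<forall>n\<ge>M. form_norm b (X m - X n) < c * e"
        using X \<open>c > 0\<close> by (metis mult_pos_pos)
      then have "\<forall>m\<ge>M. \<forall>n\<ge>M. c * N (X m - X n) < c * e"
        using lower order_le_less_trans by blast
      then show "\<exists>M. \<forall>m\<ge>M. \<forall>n\<ge>M. N (X m - X n) < e"
        using \<open>c > 0\<close> by auto
    qed
    then obtain l where l: "(\<lambda>n. N (X n - l)) \<longlonglongrightarrow> 0" by blast
    have "(\<lambda>n. form_norm b (X n - l)) \<longlonglongrightarrow> 0"
      by (rule Lim_null_comparison[OF _ tendsto_mult_right_zero[OF l, of C]]) (simp add: upper)
    then show "\<exists>l. (\<lambda>n. form_norm b (X n - l)) \<longlonglongrightarrow> 0" by blast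
  qed
  then show ?thesis by (rule b.hilbert_spaceI)
qed

subsection \<open>Riesz representation and equivalence of norms\<close>

text \<open>The representing vector minimises \<open>N y\<^sup>2 - 2 * Re (f y)\<close>.\<close>

lemma (in hilbert_space) riesz_representation:
  assumes add: "\<And>x y. f (x + y) = f x + f y" and smul: "\<And>c x. f (smul c x) = c * f x"
    and bounded: "\<And>x. cmod (f x) \<le> C * N x"
  shows "\<exists>y. \<forall>x. f x = ip x y"
proof -
  define q where "q y = (N y)\<^sup>2 - 2 * Re (f y)" for y
  have "- (C\<^sup>2) \<le> q y" for y
  proof -
    have "Re (f y) \<le> C * N y"
      using bounded[of y] complex_Re_le_cmod[of "f y"] by linarith
    moreover have "0 \<le> (N y - C)\<^sup>2" by simp
    ultimately show ?thesis
      by (simp add: q_def power2_diff mult.commute)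
  qed
  then have bdd: "bdd_below (range q)" by (intro bdd_belowI[of _ "- (C\<^sup>2)"]) auto
  define I where "I = Inf (range q)"
  have I_le: "I \<le> q y" for y
    unfolding I_def by (rule cInf_lower[OF _ bdd]) simp
  have "\<exists>y. q y < I + inverse (real (Suc n))" for n
  proof -
    have "I < I + inverse (real (Suc n))" by simp
    then show ?thesis
      unfolding I_def using cInf_lessD[of "range q"] by fast
  qed
  then obtain X where X: "\<And>n. q (X n) < I + inverse (real (Suc n))" by metis
  \<comment> \<open>By the parallelogram law, since \<open>q\<close> at the midpoint of
    \<open>x\<close> and \<open>y\<close> is at least \<open>I\<close>. Hence a minimising sequence
    is Cauchy.\<close>
  have midpoint: "(N (x - y))\<^sup>2 \<le> 2 * (q x - I) + 2 * (q y - I)" for x y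
  proof -
    have "4 * q (smul (1/2) (x + y)) = (N (x + y))\<^sup>2 - 4 * Re (f x) - 4 * Re (f y)"
      by (simp add: q_def N_smul smul add power2_eq_square add_divide_distrib)
    with I_le[of "smul (1/2) (x + y)"] show ?thesis
      by (simp add: parallelogram q_def)
  qed
  have "\<exists>l. (\<lambda>n. N (X n - l)) \<longlonglongrightarrow> 0"
  proof (rule Cauchy_converges)
    fix e :: real assume "e > 0"
    then obtain M where M: "inverse (real (Suc M)) < e\<^sup>2 / 4"
      using reals_Archimedean[of "e\<^sup>2 / 4"] by auto
    have close: "q (X m) - I < e\<^sup>2 / 4" if "m \<ge> M" for m
    proof -
      have "inverse (real (Suc m)) \<le> inverse (real (Suc M))"
        using that by (intro le_imp_inverse_le) auto
      then show ?thesis using X[of m] M by linarith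
    qed
    have "(N (X m - X n))\<^sup>2 < e\<^sup>2" if "m \<ge> M" "n \<ge> M" for m n
      using close[OF that(1)] close[OF that(2)] midpoint[of "X m" "X n"] by simp
    then show "\<exists>M. \<forall>m\<ge>M. \<forall>n\<ge>M. N (X m - X n) < e"
      using \<open>e > 0\<close> by (meson less_imp_le power_less_imp_less_base)
  qed
  then obtain l where l: "(\<lambda>n. N (X n - l)) \<longlonglongrightarrow> 0" by blast
  \<comment> \<open>The variation is taken at the near-minimiser \<open>X n\<close>, with slack
    \<open>1 / (n + 1)\<close>, and only then passed to the limit; continuity of \<open>q\<close> is
    thereby avoided.\<close>
  have variation: "0 \<le> 2 * Re (t * (ip z l - f z)) + (cmod t * N z)\<^sup>2" for t z
  proof (rule LIMSEQ_le_const)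
    show "(\<lambda>n. 2 * Re (t * (ip z (X n) - f z)) + (cmod t * N z)\<^sup>2 + inverse (real (Suc n)))
            \<longlonglongrightarrow> 2 * Re (t * (ip z l - f z)) + (cmod t * N z)\<^sup>2"
    proof (rule tendsto_eq_rhs)
      show "(\<lambda>n. 2 * Re (t * (ip z (X n) - f z)) + (cmod t * N z)\<^sup>2 + inverse (real (Suc n)))
              \<longlonglongrightarrow> 2 * Re (t * (ip z l - f z)) + (cmod t * N z)\<^sup>2 + 0"
        by (intro tendsto_add tendsto_mult tendsto_diff tendsto_Re tendsto_const
            ip_tendsto_right[OF l] LIMSEQ_inverse_real_of_nat)
    qed simp
    have "0 \<le> 2 * Re (t * (ip z (X n) - f z)) + (cmod t * N z)\<^sup>2 + inverse (real (Suc n))" for n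
    proof -
      have "q (X n + smul t z) = q (X n) + 2 * Re (t * (ip z (X n) - f z)) + (cmod t * N z)\<^sup>2"
        using Re_form_commute[of "X n" "smul t z"]
        by (simp add: q_def N_add_sq N_smul add smul form_smul_left right_diff_distrib)
      then show ?thesis
        using I_le[of "X n + smul t z"] X[of n] by linarith
    qed
    then show "\<exists>M. \<forall>n\<ge>M. 0 \<le> 2 * Re (t * (ip z (X n) - f z)) + (cmod t * N z)\<^sup>2
                              + inverse (real (Suc n))"
      by blast
  qed
  have "f z = ip z l" for z
  proof (rule ccontr)
    assume "f z \<noteq> ip z l"
    define w where "w = ip z l - f z"
    \<comment> \<open>The variation will be used with \<open>t = - s * cnj w\<close>, whose linear
      term is \<open>- 2 * s * (cmod w)\<^sup>2\<close>. As \<open>s * (N z)\<^sup>2 < 1\<close>,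
      the quadratic term cannot compensate it.\<close>
    define s where "s = 1 / ((N z)\<^sup>2 + 1)"
    have s: "s > 0" "s * (N z)\<^sup>2 < 1"
      by (auto simp: s_def divide_simps add_nonneg_pos)
    have w: "(cmod w)\<^sup>2 > 0"
      using \<open>f z \<noteq> ip z l\<close> by (simp add: w_def)
    have "(- of_real s * cnj w) * w = of_real (- (s * (cmod w)\<^sup>2))"
      by (simp only: of_real_minus of_real_mult complex_norm_square) simp
    moreover have "cmod (- of_real s * cnj w) = s * cmod w"
      using s by (simp add: norm_mult)
    ultimately have "0 \<le> 2 * (- (s * (cmod w)\<^sup>2)) + (s * cmod w * N z)\<^sup>2"
      using variation[of "- of_real s * cnj w" z] unfolding w_def[symmetric]
      by (simp only: Re_complex_of_real)
    also have "\<dots> = s * (cmod w)\<^sup>2 * (s * (N z)\<^sup>2 - 2)"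
      by (simp add: power2_eq_square algebra_simps)
    finally have "0 \<le> s * (cmod w)\<^sup>2 * (s * (N z)\<^sup>2 - 2)" .
    moreover have "s * (cmod w)\<^sup>2 * (s * (N z)\<^sup>2 - 2) < 0"
      using s w by (intro mult_pos_neg) auto
    ultimately show False by simp
  qed
  then show ?thesis by blast
qed

text \<open>Riesz is applied to \<open>b\<close> in its linear first argument with the second one
  fixed; hermitian symmetry then moves the operator to the left.\<close>

lemma (in hilbert_space) form_operator:
  assumes "hermitian_space smul b" and bounded: "\<And>x y. cmod (b x y) \<le> C * (N x * N y)"
  shows "\<exists>A. Vector_Spaces.linear smul smul A \<and> (\<forall>x y. b x y = ip (A x) y) \<and>
             (\<forall>x. N (A x) \<le> C * N x)"
proof -
  interpret b: hermitian_space smul b by fact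
  have "\<exists>y. \<forall>z. b z x = ip z y" for x
    by (rule riesz_representation[where C = "C * N x"])
       (use bounded[of _ x] in \<open>simp_all add: b.form_simps mult_ac\<close>)
  then obtain A where "\<And>x z. b z x = ip z (A x)" by metis
  then have A: "b x z = ip (A x) z" for x z
    by (metis b.form_hermitian form_hermitian)
  have "Vector_Spaces.linear smul smul A"
    unfolding linear_iff by (auto intro!: ip_ext simp: form_simps b.form_simps simp flip: A)
  moreover have "N (A x) \<le> C * N x" for x
  proof (cases "A x = 0")
    case True
    \<comment> \<open>No sign of \<open>C\<close> is assumed; the bound on \<open>b x x\<close>
      forces it once \<open>x\<close> is nonzero.\<close>
    have "0 \<le> C * N x" if "x \<noteq> 0"
    proof -
      have "0 \<le> C * (N x * N x)"
        using bounded[of x x] norm_ge_zero order_trans by blast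
      then show ?thesis
        using that by (auto simp: zero_le_mult_iff mult_le_0_iff)
    qed
    then show ?thesis using True by (cases "x = 0") auto
  next
    case False
    have "N (A x) * N (A x) = cmod (b x (A x))"
      by (simp add: A ip_self power2_eq_square norm_mult)
    also have "\<dots> \<le> (C * N x) * N (A x)"
      using bounded[of x "A x"] by (simp add: mult_ac)
    finally show ?thesis
      using False by (simp add: less_le)
  qed
  ultimately show ?thesis using A by blast
qed

text \<open>Gelfand's lemma: by Baire, the seminorm is bounded on some ball.\<close>

lemma (in hilbert_space) lsc_seminorm_bounded:
  assumes add: "\<And>x y. p (x + y) \<le> p x + p y" and smul: "\<And>c x. p (smul c x) = cmod c * p x"
    and lsc: "\<And>a. openin metric.mtopology {x. a < p x}"
  shows "\<exists>C>0. \<forall>x. p x \<le> C * N x"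
proof -
  define G where "G n = {x. real n < p x}" for n
  have "(\<Inter>n. G n) = {}"
    by (auto simp: G_def) (meson not_less_iff_gr_or_eq order_less_trans reals_Archimedean2)
  then have "metric.mtopology closure_of (\<Inter>(range G)) \<noteq> UNIV"
    by (simp add: closure_of_empty)
  \<comment> \<open>Were all the open sets \<open>G n\<close> dense, so would be their intersection,
    which is empty. A set \<open>G n\<close> that is not dense misses a ball, and there
    \<open>p\<close> is at most \<open>n\<close>.\<close>
  then obtain n where "metric.mtopology closure_of (G n) \<noteq> UNIV"
    using metric.metric_Baire_category[OF complete, of "range G"] lsc by (auto simp: G_def)
  then obtain u e where "e > 0" and u: "\<And>y. N (u - y) < e \<Longrightarrow> p y \<le> real n"
    by (force simp: metric.metric_closure_of G_def not_less)
  have "p u \<le> real n"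
    using u[of u] \<open>e > 0\<close> by simp
  \<comment> \<open>The summand 1 only makes the constant positive when
    \<open>n = 0\<close>.\<close>
  have "p x \<le> (4 * real n / e + 1) * N x" for x
  proof (cases "x = 0")
    case True
    then show ?thesis using smul[of 0 x] by simp
  next
    case False
    then have "N x > 0" by (simp add: less_le)
    define t where "t = e / (2 * N x)"
    have "t > 0" using \<open>e > 0\<close> \<open>N x > 0\<close> by (simp add: t_def)
    have "N (u - (u + smul (of_real t) x)) < e"
      using \<open>t > 0\<close> \<open>e > 0\<close> \<open>N x > 0\<close> by (simp add: N_smul t_def norm_divide norm_mult)
    then have "p (u + smul (of_real t) x) \<le> real n" by (rule u)
    moreover have "t * p x \<le> p (u + smul (of_real t) x) + p u"
      using add[of "u + smul (of_real t) x" "smul (-1) u"] smul[of "of_real t" x] smul[of "-1" u]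
        \<open>t > 0\<close> by simp
    ultimately have "t * p x \<le> 2 * real n"
      using \<open>p u \<le> real n\<close> by linarith
    then have "p x \<le> 4 * real n / e * N x"
      using \<open>e > 0\<close> \<open>N x > 0\<close> by (simp add: t_def field_simps)
    then show ?thesis
      using \<open>N x > 0\<close> by (simp add: distrib_right)
  qed
  moreover have "4 * real n / e + 1 > 0"
    using \<open>e > 0\<close> by (simp add: add_nonneg_pos)
  ultimately show ?thesis by blast
qed

section \<open>Comparison of the Hilbert norms of one Krein space\<close>

lemma
  assumes "fundamental_pair smul form ip J"
  shows fundamental_pair_hilbert_space: "hilbert_space smul ip"
    and fundamental_pair_linear: "Vector_Spaces.linear smul smul J"
    and fundamental_pair_involution: "J (J x) = x"
    and fundamental_pair_form: "form x y = ip (J x) y"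
  using assms by (auto simp: fundamental_pair_def)

lemma fundamental_pair_norm:
  assumes "fundamental_pair smul form ip J"
  shows "form_norm ip (J x) = form_norm ip x"
  using assms by (simp add: form_norm_def fundamental_pair_def)

lemma fundamental_pair_form_bound:
  assumes "fundamental_pair smul form ip J"
  shows "cmod (form x y) \<le> form_norm ip x * form_norm ip y"
proof -
  interpret hilbert_space smul ip
    using assms by (rule fundamental_pair_hilbert_space)
  show ?thesis
    using Cauchy_Schwarz[of "J x" y] fundamental_pair_norm[OF assms]
      fundamental_pair_form[OF assms] by simp
qed

text \<open>The norm of \<open>ip'\<close> is the supremum of the functionals \<open>\<lambda>x. \<bar>form x y\<bar>\<close> with \<open>y\<close> in
  its unit ball, each of which is continuous for the norm of \<open>ip\<close>.\<close>

lemma fundamental_pair_norm_bound: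
  assumes p: "fundamental_pair smul form ip J" and p': "fundamental_pair smul form ip' J'"
  shows "\<exists>C>0. \<forall>x. form_norm ip' x \<le> C * form_norm ip x"
proof -
  interpret H: hilbert_space smul ip
    using p by (rule fundamental_pair_hilbert_space)
  interpret H': hilbert_space smul ip'
    using p' by (rule fundamental_pair_hilbert_space)
  have "openin H.metric.mtopology {x. a < H'.N x}" for a
    unfolding H.metric.openin_mtopology
  proof (intro conjI allI impI)
    fix x assume "x \<in> {x. a < H'.N x}"
    then have x: "a < H'.N x" by simp
    show "\<exists>r>0. H.metric.mball x r \<subseteq> {x. a < H'.N x}"
    proof (cases "x = 0")
      case True
      then have "a < 0" using x by simp
      then have "a < H'.N y" for y using H'.N_nonneg[of y] by linarith
      then show ?thesis by (auto intro: exI[of _ 1])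
    next
      case False
      then have pos: "H'.N x > 0" by (simp add: less_le)
      \<comment> \<open>Chosen so that the error \<open>form (x - y) (J' x)\<close> stays below
        \<open>H'.N x * (H'.N x - a)\<close>.\<close>
      define r where "r = H'.N x * (H'.N x - a) / (H.N (J' x) + 1)"
      have d: "H.N (J' x) + 1 > 0" by (simp add: add_nonneg_pos)
      have "r > 0" using x pos d by (simp add: r_def)
      have "a < H'.N y" if "H.N (x - y) < r" for y
      proof -
        \<comment> \<open>Up to scaling, \<open>J' x\<close> is the vector at which the supremum
          defining \<open>H'.N x\<close> is attained.\<close>
        have "form x (J' x) = ip' x x"
          using p' by (simp add: fundamental_pair_def)
        then have "(H'.N x)\<^sup>2 = Re (form x (J' x))"
          by (simp add: H'.N_sq)
        also have "form x (J' x) = form (x - y) (J' x) + form y (J' x)"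
          using H.form_diff_left[of "J x" "J y"] fundamental_pair_linear[OF p]
          by (simp add: fundamental_pair_form[OF p] H.linear_iff)
             (metis H.form_add_left diff_add_cancel)
        also have "Re \<dots> \<le> cmod (form (x - y) (J' x)) + cmod (form y (J' x))"
          using complex_Re_le_cmod[of "form (x - y) (J' x)"] complex_Re_le_cmod[of "form y (J' x)"]
          by simp
        also have "\<dots> \<le> H.N (x - y) * H.N (J' x) + H'.N y * H'.N x"
          using fundamental_pair_form_bound[OF p, of "x - y" "J' x"]
            fundamental_pair_form_bound[OF p', of y "J' x"] fundamental_pair_norm[OF p', of x] by simp
        also have "H.N (x - y) * H.N (J' x) \<le> H.N (x - y) * (H.N (J' x) + 1)"
          by (simp add: distrib_left)
        also have "\<dots> < r * (H.N (J' x) + 1)"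
          using that d by (rule mult_strict_right_mono)
        also have "r * (H.N (J' x) + 1) = H'.N x * (H'.N x - a)"
          using d by (simp add: r_def)
        finally have "H'.N x * a < H'.N x * H'.N y"
          by (simp add: power2_eq_square algebra_simps)
        then show ?thesis using pos by simp
      qed
      then show ?thesis using \<open>r > 0\<close> by (auto intro!: exI[of _ r])
    qed
  qed auto
  then show ?thesis
    by (rule H.lsc_seminorm_bounded[OF H'.N_triangle H'.N_smul])
qed

subsection \<open>Absolute value of a selfadjoint operator\<close>

lemma (in hilbert_space) geometric_converges:
  assumes "0 \<le> q" "q < 1" and step: "\<And>n. N (X (Suc n) - X n) \<le> K * q ^ n"
  shows "\<exists>l. (\<lambda>n. N (X n - l)) \<longlonglongrightarrow> 0"
proof (rule Cauchy_converges)
  fix e :: real assume "e > 0"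
  have "K \<ge> 0"
    using step[of 0] order_trans[OF N_nonneg] by simp
  \<comment> \<open>The exact geometric sum is kept, because the weaker bound without the subtracted
    term would not survive the induction.\<close>
  have tail: "N (X (n + k) - X n) \<le> K * (q ^ n - q ^ (n + k)) / (1 - q)" for n k
  proof (induction k)
    case (Suc k)
    have "N (X (n + Suc k) - X n) \<le> K * q ^ (n + k) + N (X (n + k) - X n)"
      using N_triangle_diff[of "X (Suc (n + k))" "X n" "X (n + k)"] step[of "n + k"] by simp
    also have "\<dots> \<le> K * q ^ (n + k) + K * (q ^ n - q ^ (n + k)) / (1 - q)"
      using Suc.IH by simp
    also have "\<dots> = K * (q ^ n - q ^ (n + Suc k)) / (1 - q)"
      using \<open>q < 1\<close> by (simp add: divide_simps) (simp add: algebra_simps)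
    finally show ?case .
  qed simp
  have "(\<lambda>n. K * q ^ n / (1 - q)) \<longlonglongrightarrow> K * 0 / (1 - q)"
    using assms by (intro tendsto_divide tendsto_mult tendsto_const LIMSEQ_realpow_zero) auto
  then have "(\<lambda>n. K * q ^ n / (1 - q)) \<longlonglongrightarrow> 0" by simp
  then have "\<forall>\<^sub>F n in sequentially. K * q ^ n / (1 - q) < e / 2"
    by (rule order_tendstoD(2)) (use \<open>e > 0\<close> in simp)
  then have "\<exists>M. K * q ^ M / (1 - q) < e / 2"
    by (rule eventually_happens'[OF sequentially_bot])
  then obtain M where M: "K * q ^ M / (1 - q) < e / 2" ..
  have close: "N (X m - X M) < e / 2" if "m \<ge> M" for m
  proof -
    from le_Suc_ex[OF that] obtain k where k: "m = M + k" ..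
    have "K * (q ^ M - q ^ (M + k)) / (1 - q) \<le> K * q ^ M / (1 - q)"
      using \<open>K \<ge> 0\<close> assms by (intro divide_right_mono mult_left_mono) auto
    then show ?thesis
      unfolding k using tail[of M k] M by linarith
  qed
  have "N (X m - X n) < e" if "m \<ge> M" "n \<ge> M" for m n
    using close[OF that(1)] close[OF that(2)]
      N_triangle_diff[of "X m" "X n" "X M"] N_minus_commute[of "X M" "X n"] by linarith
  then show "\<exists>M. \<forall>m\<ge>M. \<forall>n\<ge>M. N (X m - X n) < e" by blast
qed

text \<open>Norm limits are weak limits. Algebraic identities for a strong limit of operators can
  thus be checked one inner product at a time.\<close>

lemma (in pre_hilbert_space) limit_unique:
  assumes "(\<lambda>n. N (X n - l)) \<longlonglongrightarrow> 0" and "\<And>z. (\<lambda>n. ip (X n) z) \<longlonglongrightarrow> ip l' z"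
  shows "l = l'"
proof (rule ip_ext)
  show "ip l z = ip l' z" for z
    by (rule LIMSEQ_unique[OF ip_tendsto_left[OF assms(1)] assms(2)])
qed

text \<open>For a contraction \<open>B\<close>, the iteration \<open>Y := (B + Y\<^sup>2) / 2\<close> converges to
  \<open>L = I - (I - B)\<^sup>1\<^sup>/\<^sup>2\<close>.\<close>

lemma (in hilbert_space) square_root_iteration:
  assumes lin: "Vector_Spaces.linear smul smul B"
    and sa: "\<And>x y. ip (B x) y = ip x (B y)"
    and q: "0 \<le> q" "q < 1" and B: "\<And>x. N (B x) \<le> q * N x"
  shows "\<exists>L. Vector_Spaces.linear smul smul L \<and> (\<forall>x y. ip (L x) y = ip x (L y)) \<and>
             (\<forall>x. N (L x) \<le> q * N x) \<and> (\<forall>x. L x = smul (1/2) (B x + L (L x))) \<and>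
             (\<forall>V W. Vector_Spaces.linear smul smul V \<longrightarrow> is_form_adjoint ip V W \<longrightarrow>
                    (\<forall>x. V (B x) = B (V x)) \<longrightarrow> (\<forall>x. V (L x) = L (V x)))"
proof -
  define Y where "Y = rec_nat (\<lambda>x. 0) (\<lambda>n T x. smul (1/2) (B x + T (T x)))"
  have Y0: "Y 0 x = 0" and YS: "Y (Suc n) x = smul (1/2) (B x + Y n (Y n x))" for n x
    by (simp_all add: Y_def)
  have B_add: "B (x + y) = B x + B y" and B_smul: "B (smul c x) = smul c (B x)" for x y c
    using lin by (simp_all add: linear_iff)
  have Y_add: "Y n (x + y) = Y n x + Y n y" for n x y
    by (induction n arbitrary: x y) (simp_all add: Y0 YS B_add scale_right_distrib add_ac)
  have Y_smul: "Y n (smul c x) = smul c (Y n x)" for n x c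
    by (induction n arbitrary: x) (simp_all add: Y0 YS B_smul scale_right_distrib mult.commute)
  have Y_diff: "Y n (x - y) = Y n x - Y n y" for n x y
    using Y_add[of n "x - y" y] by simp
  have Y_sa: "ip (Y n x) y = ip x (Y n y)" for n x y
    by (induction n arbitrary: x y) (simp_all add: Y0 YS form_simps sa)
  \<comment> \<open>The square of \<open>Y n\<close> has bound \<open>q * q \<le> q\<close>, so its
    average with \<open>B\<close> keeps the bound \<open>q\<close>.\<close>
  have Y_bound: "N (Y n x) \<le> q * N x" for n x
  proof (induction n arbitrary: x)
    case (Suc n)
    have "N (Y n (Y n x)) \<le> q * (q * N x)"
      using Suc[of "Y n x"] mult_left_mono[OF Suc[of x] q(1)] by linarith
    also have "\<dots> \<le> 1 * (q * N x)"
      using q by (intro mult_right_mono) auto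
    finally show ?case
      using N_triangle[of "B x" "Y n (Y n x)"] B[of x] by (simp add: YS N_smul)
  qed (simp add: Y0 q)
  \<comment> \<open>With \<open>Z\<close> the difference of two successive iterates, the difference
    of their squares is \<open>Y (Suc n)\<close> after \<open>Z\<close> plus \<open>Z\<close> after
    \<open>Y n\<close>. Each term gains a factor \<open>q\<close>, and the 1/2 absorbs their
    number.\<close>
  have Y_step: "N (Y (Suc n) x - Y n x) \<le> N x * q ^ n" for n x
  proof (induction n arbitrary: x)
    case 0
    have "N (B x) \<le> 1 * N x"
      using B[of x] q mult_right_mono[of q 1 "N x"] by simp
    then show ?case using N_nonneg[of x] by (simp add: Y0 YS N_smul del: N_nonneg)
  next
    case (Suc n)
    let ?Z = "\<lambda>x. Y (Suc n) x - Y n x"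
    have "Y (Suc (Suc n)) x - Y (Suc n) x = smul (1/2) (Y (Suc n) (?Z x) + ?Z (Y n x))"
      by (subst (1) YS, subst (3) YS)
         (simp add: Y_diff scale_right_distrib scale_right_diff_distrib)
    then have "N (Y (Suc (Suc n)) x - Y (Suc n) x) \<le> (N (Y (Suc n) (?Z x)) + N (?Z (Y n x))) / 2"
      using N_triangle by (simp add: N_smul)
    also have "N (Y (Suc n) (?Z x)) \<le> q * (N x * q ^ n)"
      using Y_bound[of "Suc n" "?Z x"] mult_left_mono[OF Suc[of x] q(1)] by linarith
    also have "N (?Z (Y n x)) \<le> q * N x * q ^ n"
      using Suc[of "Y n x"] mult_right_mono[OF Y_bound[of n x], of "q ^ n"] q(1) by simp
    finally show ?case by (simp add: mult_ac)
  qed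
  have "\<exists>l. (\<lambda>n. N (Y n x - l)) \<longlonglongrightarrow> 0" for x
    by (rule geometric_converges[OF q Y_step])
  then obtain L where L: "\<And>x. (\<lambda>n. N (Y n x - L x)) \<longlonglongrightarrow> 0" by metis
  have lin_L: "Vector_Spaces.linear smul smul L"
    unfolding linear_iff
  proof (intro conjI allI)
    show "L (x + y) = L x + L y" for x y
    proof (rule limit_unique[OF L])
      show "(\<lambda>n. ip (Y n (x + y)) z) \<longlonglongrightarrow> ip (L x + L y) z" for z
        unfolding Y_add form_add_left by (intro tendsto_add ip_tendsto_left[OF L])
    qed
    show "L (smul c x) = smul c (L x)" for c x
    proof (rule limit_unique[OF L])
      show "(\<lambda>n. ip (Y n (smul c x)) z) \<longlonglongrightarrow> ip (smul c (L x)) z" for z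
        unfolding Y_smul form_smul_left by (intro tendsto_mult_left ip_tendsto_left[OF L])
    qed
  qed
  have sa_L: "ip (L x) y = ip x (L y)" for x y
    using ip_tendsto_left[OF L, of x y] ip_tendsto_right[OF L, of x y]
    unfolding Y_sa by (rule LIMSEQ_unique)
  have L_bound: "N (L x) \<le> q * N x" for x
  proof (rule LIMSEQ_le_const)
    show "(\<lambda>n. N (Y n x - L x) + q * N x) \<longlonglongrightarrow> q * N x"
      using tendsto_add[OF L tendsto_const, of x "q * N x"] by simp
    show "\<exists>M. \<forall>n\<ge>M. N (L x) \<le> N (Y n x - L x) + q * N x"
    proof (intro exI allI impI)
      fix n
      show "N (L x) \<le> N (Y n x - L x) + q * N x"
        using N_triangle[of "L x - Y n x" "Y n x"] Y_bound[of n x] N_minus_commute[of "L x" "Y n x"]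
        by simp
    qed
  qed
  have fixpoint: "L x = smul (1/2) (B x + L (L x))" for x
  proof (rule limit_unique[OF LIMSEQ_Suc[OF L]])
    fix z
    \<comment> \<open>Composition preserves this pointwise limit because all \<open>Y n\<close>
      share the bound \<open>q\<close>.\<close>
    have "(\<lambda>n. N (Y n (Y n x) - L (L x))) \<longlonglongrightarrow> 0"
    proof (rule Lim_null_comparison)
      show "\<forall>\<^sub>F n in sequentially. norm (N (Y n (Y n x) - L (L x)))
              \<le> q * N (Y n x - L x) + N (Y n (L x) - L (L x))"
      proof (intro always_eventually allI)
        fix n
        show "norm (N (Y n (Y n x) - L (L x))) \<le> q * N (Y n x - L x) + N (Y n (L x) - L (L x))"
          using N_triangle_diff[of "Y n (Y n x)" "L (L x)" "Y n (L x)"]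
            Y_bound[of n "Y n x - L x"] by (simp add: Y_diff)
      qed
      show "(\<lambda>n. q * N (Y n x - L x) + N (Y n (L x) - L (L x))) \<longlonglongrightarrow> 0"
        using tendsto_add[OF tendsto_mult_right_zero[OF L] L] by simp
    qed
    then show "(\<lambda>n. ip (Y (Suc n) x) z) \<longlonglongrightarrow> ip (smul (1/2) (B x + L (L x))) z"
      unfolding YS form_smul_left form_add_left
      by (intro tendsto_mult_left tendsto_add tendsto_const ip_tendsto_left)
  qed
  have commute: "V (L x) = L (V x)"
    if V: "Vector_Spaces.linear smul smul V" "is_form_adjoint ip V W" "\<And>x. V (B x) = B (V x)"
    for V W x
  proof -
    have V_Y: "V (Y n x) = Y n (V x)" for n x
    proof (induction n arbitrary: x)
      case 0
      show ?case using V(1) unfolding linear_iff Y0 by (metis scale_zero_left)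
    next
      case (Suc n)
      then show ?case using V by (simp add: YS linear_iff)
    qed
    have "L (V x) = V (L x)"
    proof (rule limit_unique[OF L])
      show "(\<lambda>n. ip (Y n (V x)) z) \<longlonglongrightarrow> ip (V (L x)) z" for z
        using ip_tendsto_left[OF L, of x "W z"] V(2) by (simp add: is_form_adjoint_def flip: V_Y)
    qed
    then show ?thesis by simp
  qed
  show ?thesis
    using lin_L sa_L L_bound fixpoint commute by blast
qed

text \<open>\<open>P\<close> is \<open>M\<close> times the square root of \<open>I - B\<close>,
  where \<open>B\<close> is \<open>I\<close> minus the square of \<open>A / M\<close>. The lower
  bound \<open>\<delta>\<close> makes \<open>B\<close> a strict contraction, so the iteration
  applies.\<close>

lemma (in hilbert_space) absolute_value_operator:
  assumes lin: "Vector_Spaces.linear smul smul A"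
    and sa: "\<And>x y. ip (A x) y = ip x (A y)"
    and "\<delta> > 0" and lower: "\<And>x. \<delta> * N x \<le> N (A x)" and upper: "\<And>x. N (A x) \<le> C * N x"
  shows "\<exists>P c K. Vector_Spaces.linear smul smul P \<and> (\<forall>x y. ip (P x) y = ip x (P y)) \<and>
             (\<forall>x. P (P x) = A (A x)) \<and>
             c > 0 \<and> (\<forall>x. c * (N x)\<^sup>2 \<le> Re (ip (P x) x)) \<and> (\<forall>x. N (P x) \<le> K * N x) \<and>
             (\<forall>V W. Vector_Spaces.linear smul smul V \<longrightarrow> is_form_adjoint ip V W \<longrightarrow>
                    (\<forall>x. V (A x) = A (V x)) \<longrightarrow> (\<forall>x. V (P x) = P (V x)))"
proof -
  \<comment> \<open>The maximum ensures \<open>M > 0\<close> and \<open>\<delta> / M \<le> 1\<close>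
    even on the zero space, where \<open>C\<close> is arbitrary.\<close>
  define M where "M = max C \<delta>"
  have M: "\<delta> \<le> M" "M > 0" and upper': "N (A x) \<le> M * N x" for x
    using \<open>\<delta> > 0\<close> order_trans[OF upper mult_right_mono[of C M "N x"]] by (auto simp: M_def)
  have A_add: "A (x + y) = A x + A y" and A_smul: "A (smul c x) = smul c (A x)" for x y c
    using lin by (simp_all add: linear_iff)
  define B where "B x = x - smul (of_real (1 / M\<^sup>2)) (A (A x))" for x
  \<comment> \<open>Expanding \<open>(N (B x))\<^sup>2\<close> gives at most
    \<open>(N x)\<^sup>2 - (N (A x))\<^sup>2 / M\<^sup>2\<close>, and the lower bound on
    \<open>A\<close> then yields exactly this \<open>q\<close>.\<close>
  define q where "q = sqrt (1 - \<delta>\<^sup>2 / M\<^sup>2)"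
  have "\<delta>\<^sup>2 / M\<^sup>2 \<le> 1"
    using M \<open>\<delta> > 0\<close> by (simp add: power_mono)
  moreover have "\<delta>\<^sup>2 / M\<^sup>2 > 0"
    using M \<open>\<delta> > 0\<close> by simp
  ultimately have q: "0 \<le> q" "q < 1" "q\<^sup>2 = 1 - \<delta>\<^sup>2 / M\<^sup>2"
    by (simp_all add: q_def)
  have B_lin: "Vector_Spaces.linear smul smul B"
    by (simp add: linear_iff B_def A_add A_smul scale_right_distrib scale_right_diff_distrib mult.commute)
  have B_sa: "ip (B x) y = ip x (B y)" for x y
    by (simp add: B_def form_simps sa)
  have B_bound: "N (B x) \<le> q * N x" for x
  proof (rule power2_le_imp_le)
    have "Re (ip x (smul (of_real (1 / M\<^sup>2)) (A (A x)))) = (N (A x))\<^sup>2 / M\<^sup>2"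
      by (simp add: form_smul_right N_sq flip: sa)
    then have "(N (B x))\<^sup>2 = (N x)\<^sup>2 - 2 * (N (A x))\<^sup>2 / M\<^sup>2 + (N (A (A x)) / M\<^sup>2)\<^sup>2"
      by (simp add: B_def N_diff_sq N_smul norm_divide norm_power)
    also have "(N (A (A x)) / M\<^sup>2)\<^sup>2 \<le> (M * N (A x) / M\<^sup>2)\<^sup>2"
      using upper' by (intro power_mono divide_right_mono) auto
    also have "\<dots> = (N (A x))\<^sup>2 / M\<^sup>2"
      using M by (simp add: power2_eq_square)
    also have "(N x)\<^sup>2 - 2 * (N (A x))\<^sup>2 / M\<^sup>2 + (N (A x))\<^sup>2 / M\<^sup>2 = (N x)\<^sup>2 - (N (A x))\<^sup>2 / M\<^sup>2"
      by simp
    also have "\<dots> \<le> (N x)\<^sup>2 - (\<delta> * N x)\<^sup>2 / M\<^sup>2"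
      using lower \<open>\<delta> > 0\<close> by (intro diff_left_mono divide_right_mono power_mono) auto
    also have "\<dots> = (q * N x)\<^sup>2"
      by (simp add: power_mult_distrib q(3) left_diff_distrib)
    finally show "(N (B x))\<^sup>2 \<le> (q * N x)\<^sup>2" by simp
  qed (simp add: q)
  obtain L where L: "Vector_Spaces.linear smul smul L" "\<And>x y. ip (L x) y = ip x (L y)"
      "\<And>x. N (L x) \<le> q * N x" "\<And>x. L x = smul (1/2) (B x + L (L x))"
      and L_commute: "\<And>V W x. Vector_Spaces.linear smul smul V \<Longrightarrow> is_form_adjoint ip V W \<Longrightarrow>
                    (\<And>x. V (B x) = B (V x)) \<Longrightarrow> V (L x) = L (V x)"
    using square_root_iteration[OF B_lin B_sa q(1,2) B_bound] by metis
  have L_add: "L (x + y) = L x + L y" and L_smul: "L (smul c x) = smul c (L x)" for x y c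
    using L(1) by (simp_all add: linear_iff)
  have L_diff: "L (x - y) = L x - L y" for x y
    using L_add[of "x - y" y] by simp
  define P where "P x = smul (of_real M) (x - L x)" for x
  have "Vector_Spaces.linear smul smul P"
    by (simp add: linear_iff P_def L_add L_smul scale_right_distrib scale_right_diff_distrib mult.commute)
  moreover have "ip (P x) y = ip x (P y)" for x y
    by (simp add: P_def form_simps L(2))
  moreover have "P (P x) = A (A x)" for x
  proof -
    \<comment> \<open>The fixed point equation says that the square of \<open>I - L\<close> is
      \<open>I - B\<close>.\<close>
    have "smul 2 (L x) = smul 2 (smul (1/2) (B x + L (L x)))"
      by (subst L(4)) (rule refl)
    then have "L x + L x = B x + L (L x)"
      using scale_left_distrib[of 1 1 "L x"] by simp
    then have "x - L x - (L x - L (L x)) = x - B x"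
      by (simp add: algebra_simps)
    then have "smul (of_real (M\<^sup>2)) (x - L x - L (x - L x)) = A (A x)"
      using M by (simp add: L_diff B_def)
    then show ?thesis
      by (simp only: P_def L_smul scale_right_diff_distrib[symmetric] scale_scale
          power2_eq_square of_real_mult)
  qed
  moreover have "M * (1 - q) > 0"
    using M q by simp
  moreover have "M * (1 - q) * (N x)\<^sup>2 \<le> Re (ip (P x) x)" for x
  proof -
    have "Re (ip (L x) x) \<le> N (L x) * N x"
      using Cauchy_Schwarz complex_Re_le_cmod order_trans by blast
    also have "\<dots> \<le> q * N x * N x"
      using L(3) by (intro mult_right_mono) auto
    finally have "(1 - q) * (N x)\<^sup>2 \<le> Re (ip (x - L x) x)"
      by (simp add: form_diff_left N_sq[symmetric] left_diff_distrib)
         (simp add: power2_eq_square mult.assoc)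
    then show ?thesis
      using M mult_left_mono[of _ _ M] by (simp add: P_def form_smul_left mult.assoc)
  qed
  moreover have "N (P x) \<le> M * (1 + q) * N x" for x
  proof -
    have "N (x - L x) \<le> (1 + q) * N x"
      using N_triangle[of x "- L x"] L(3)[of x] by (simp add: distrib_right)
    then show ?thesis
      using M mult_left_mono[of _ _ M] by (simp add: P_def N_smul mult.assoc)
  qed
  moreover have "V (P x) = P (V x)"
    if V: "Vector_Spaces.linear smul smul V" "is_form_adjoint ip V W" "\<And>x. V (A x) = A (V x)"
    for V W x
  proof -
    have V_diff: "V (x - y) = V x - V y" for x y
      using V(1) unfolding linear_iff by (metis add_diff_cancel diff_add_cancel)
    have "V (B x) = B (V x)" for x
      using V(1,3) by (simp add: B_def V_diff linear_iff)
    then have "V (L x) = L (V x)" by (rule L_commute[OF V(1,2)])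
    then show ?thesis using V(1) by (simp add: P_def V_diff linear_iff)
  qed
  ultimately show ?thesis by blast
qed

subsection \<open>Fundamental reducibility and similarity\<close>

text \<open>In the proof, \<open>G\<close> is the inverse of \<open>A\<close> and \<open>P\<close> is \<open>|A|\<close>; the inner product of the new
  fundamental symmetry \<open>G \<circ> P\<close> is \<open>ip' (P x) y\<close>.\<close>

lemma fundamentally_reducibleI:
  assumes p: "fundamental_pair smul form ip J" and form: "hermitian_space smul form"
    and ip': "hermitian_space smul ip'"
    and "m > 0" and lower: "\<And>x. m * form_norm ip x \<le> form_norm ip' x"
    and upper: "\<And>x. form_norm ip' x \<le> M * form_norm ip x"
    and U: "\<And>a. Vector_Spaces.linear smul smul (U a)"
    and adj: "\<And>a. is_form_adjoint form (U a) (V a)" and adj': "\<And>a. is_form_adjoint ip' (U a) (V a)"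
  shows "fundamentally_reducible smul form U"
proof -
  interpret F: hermitian_space smul form by fact
  interpret H: hilbert_space smul ip
    using p by (rule fundamental_pair_hilbert_space)
  interpret H': hilbert_space smul ip'
    using H.equivalent_hilbert_space[OF ip' \<open>m > 0\<close> lower upper] .
  have lower': "H.N x \<le> H'.N x / m" for x
    using lower[of x] \<open>m > 0\<close> by (simp add: field_simps)
  have "cmod (form x y) \<le> 1 / m\<^sup>2 * (H'.N x * H'.N y)" for x y
  proof -
    have "cmod (form x y) \<le> H.N x * H.N y"
      using p by (rule fundamental_pair_form_bound)
    also have "\<dots> \<le> (H'.N x / m) * (H'.N y / m)"
      using lower' \<open>m > 0\<close> by (intro mult_mono) auto
    finally show ?thesis by (simp add: power2_eq_square)
  qed
  then obtain A where A: "Vector_Spaces.linear smul smul A" "\<And>x y. form x y = ip' (A x) y"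
      "\<And>x. H'.N (A x) \<le> 1 / m\<^sup>2 * H'.N x"
    using H'.form_operator[OF form] by metis
  have "cmod (ip' x y) \<le> M\<^sup>2 * (H.N x * H.N y)" for x y
  proof -
    have "cmod (ip' x y) \<le> H'.N x * H'.N y"
      by (rule H'.Cauchy_Schwarz)
    also have "\<dots> \<le> (M * H.N x) * (M * H.N y)"
      using upper order_trans[OF H'.N_nonneg upper] by (intro mult_mono) auto
    finally show ?thesis by (simp add: power2_eq_square mult_ac)
  qed
  then obtain R where R: "Vector_Spaces.linear smul smul R" "\<And>x y. ip' x y = ip (R x) y"
      "\<And>x. H.N (R x) \<le> M\<^sup>2 * H.N x"
    using H.form_operator[OF ip'] by metis
  \<comment> \<open>Since \<open>J\<close> turns \<open>ip\<close> into \<open>form\<close>, this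
    \<open>G\<close> represents \<open>ip'\<close> by \<open>form\<close>, just as \<open>A\<close>
    represents \<open>form\<close> by \<open>ip'\<close>.\<close>
  define G where "G x = J (R x)" for x
  have G: "form (G x) y = ip' x y" for x y
    by (simp add: G_def fundamental_pair_form[OF p] fundamental_pair_involution[OF p] R(2))
  have G_lin: "Vector_Spaces.linear smul smul G"
    using R(1) fundamental_pair_linear[OF p] by (simp add: G_def H.linear_iff)
  have AG: "A (G x) = x" for x
    by (rule H'.ip_ext) (simp add: G flip: A(2))
  \<comment> \<open>\<open>A\<close> is injective because \<open>form\<close> is nondegenerate, so
    its right inverse \<open>G\<close> is two-sided.\<close>
  have GA: "G (A x) = x" for x
  proof -
    have "ip' (A (G (A x))) z = ip' (A x) z" for z
      by (simp add: AG)
    then have "ip (J (G (A x))) z = ip (J x) z" for z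
      by (simp flip: A(2) fundamental_pair_form[OF p])
    then have "J (G (A x)) = J x" by (rule H.ip_ext)
    then show ?thesis by (metis fundamental_pair_involution[OF p])
  qed
  have A_sa: "ip' (A x) y = ip' x (A y)" for x y
    by (metis A(2) F.form_hermitian H'.form_hermitian)
  have G_sa: "ip' (G x) y = ip' x (G y)" for x y
    by (metis A_sa AG)
  \<comment> \<open>A bound on the inverse is a lower bound on \<open>A\<close>; adding 1 makes the
    constant safe to divide by.\<close>
  have "H'.N (G x) \<le> (\<bar>M\<bar> * (M\<^sup>2 / m) + 1) * H'.N x" for x
  proof -
    have "H'.N (G x) \<le> M * H.N (G x)" by (rule upper)
    also have "\<dots> \<le> \<bar>M\<bar> * H.N (R x)"
      by (simp add: G_def fundamental_pair_norm[OF p] mult_right_mono)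
    also have "\<dots> \<le> \<bar>M\<bar> * (M\<^sup>2 * (H'.N x / m))"
      using R(3)[of x] mult_left_mono[OF lower'[of x], of "M\<^sup>2"]
      by (intro mult_left_mono) auto
    finally show ?thesis
      using H'.N_nonneg[of x] by (simp add: distrib_right del: H'.N_nonneg)
  qed
  moreover have K: "\<bar>M\<bar> * (M\<^sup>2 / m) + 1 > 0"
    using \<open>m > 0\<close> by (simp add: add_nonneg_pos)
  ultimately have A_lower: "1 / (\<bar>M\<bar> * (M\<^sup>2 / m) + 1) * H'.N x \<le> H'.N (A x)" for x
    by (metis GA mult.commute mult_1 pos_divide_le_eq times_divide_eq_left)
  have "1 / (\<bar>M\<bar> * (M\<^sup>2 / m) + 1) > 0"
    using K by simp
  from H'.absolute_value_operator[OF A(1) A_sa this A_lower A(3)]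
  obtain P c K where P_lin: "Vector_Spaces.linear smul smul P"
    and P_sa: "\<forall>x y. ip' (P x) y = ip' x (P y)" and PP: "\<forall>x. P (P x) = A (A x)"
    and "c > 0" and P_lower: "\<forall>x. c * (H'.N x)\<^sup>2 \<le> Re (ip' (P x) x)"
    and P_upper: "\<forall>x. H'.N (P x) \<le> K * H'.N x"
    and P_commute: "\<forall>V W. Vector_Spaces.linear smul smul V \<longrightarrow> is_form_adjoint ip' V W \<longrightarrow>
                    (\<forall>x. V (A x) = A (V x)) \<longrightarrow> (\<forall>x. V (P x) = P (V x))"
    by (elim exE conjE) (rule that)
  note P = P_lin P_sa[rule_format] PP[rule_format] \<open>c > 0\<close> P_lower[rule_format] P_upper[rule_format]
  \<comment> \<open>Both forms give \<open>U a\<close> the same adjoint \<open>V a\<close>, so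
    \<open>ip' (A x) (V a z) = form x (V a z)\<close> can be read in two ways.\<close>
  have UA: "U a (A x) = A (U a x)" for a x
  proof (rule H'.ip_ext)
    fix z
    have "ip' (U a (A x)) z = ip' (A x) (V a z)"
      using adj'[of a] by (simp add: is_form_adjoint_def)
    also have "\<dots> = form (U a x) z"
      using adj[of a] by (simp add: is_form_adjoint_def A(2))
    finally show "ip' (U a (A x)) z = ip' (A (U a x)) z"
      by (simp add: A(2))
  qed
  have UG: "U a (G x) = G (U a x)" for a x
    by (metis UA AG GA)
  have UP: "U a (P x) = P (U a x)" for a x
    using P_commute U adj' UA by blast
  have GP: "G (P x) = P (G x)" for x
    using P_commute[rule_format, OF G_lin, of G] by (simp add: is_form_adjoint_def G_sa AG GA)
  define S where "S x = G (P x)" for x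
  define b where "b x y = ip' (P x) y" for x y
  have b_form: "b x y = form (S x) y" for x y
    by (simp add: b_def S_def G)
  \<comment> \<open>\<open>G\<close> commutes with \<open>P\<close>, so this is \<open>G\<close>
    twice after \<open>P\<close> twice, that is, \<open>G\<close> twice after \<open>A\<close>
    twice.\<close>
  have SS: "S (S x) = x" for x
    by (simp add: S_def P(3) AG GA flip: GP)
  have form_b: "form x y = b (S x) y" for x y
    by (simp add: b_form SS)
  have b_hermitian: "b y x = cnj (b x y)" for x y
    by (metis P(2) H'.form_hermitian b_def)
  have b_space: "hermitian_space smul b"
  proof
    show "b (x + y) z = b x z + b y z" "b (smul c x) y = c * b x y" for c x y z
      using P(1) by (simp_all add: b_def H.linear_iff H'.form_simps)
  qed (rule b_hermitian)
  have b_hilbert: "hilbert_space smul b"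
  proof (rule H'.equivalent_hilbert_space[OF b_space])
    show "sqrt c > 0" using \<open>c > 0\<close> by simp
    show "sqrt c * H'.N x \<le> form_norm b x" for x
      using P(5)[of x] real_sqrt_le_mono[OF P(5)[of x]]
      by (simp add: form_norm_def[of b] b_def real_sqrt_mult)
    show "form_norm b x \<le> sqrt K * H'.N x" for x
    proof -
      have "Re (ip' (P x) x) \<le> H'.N (P x) * H'.N x"
        using H'.Cauchy_Schwarz complex_Re_le_cmod order_trans by blast
      also have "\<dots> \<le> (K * H'.N x) * H'.N x"
        using P(6) by (intro mult_right_mono) auto
      finally have "sqrt (Re (ip' (P x) x)) \<le> sqrt (K * (H'.N x)\<^sup>2)"
        by (simp add: power2_eq_square mult_ac)
      then show ?thesis
        by (simp add: form_norm_def[of b] b_def real_sqrt_mult)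
    qed
  qed
  have "fundamental_pair smul form b S"
    unfolding fundamental_pair_def
  proof (intro conjI allI)
    show "hilbert_space smul b" by fact
    show "Vector_Spaces.linear smul smul S"
      using P(1) G_lin by (simp add: S_def H.linear_iff)
    \<comment> \<open>\<open>b (S x) y\<close> is \<open>form x y\<close>, so this is the hermitian
      symmetry of \<open>form\<close> and \<open>b\<close>.\<close>
    show "b (S x) y = b x (S y)" for x y
      by (metis F.form_hermitian b_hermitian form_b)
  qed (fact SS form_b)+
  moreover have "U a \<circ> S = S \<circ> U a" for a
    by (auto simp: S_def UP UG)
  ultimately show ?thesis
    unfolding fundamentally_reducible_def fundamental_symmetry_def by blast
qed

section \<open>The two implications\<close>

lemma symmetric_projective_rep_adjoint:
  "symmetric_projective_rep \<II> \<sigma> smul form U \<Longrightarrow>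
     is_form_adjoint form (U a) (\<lambda>x. smul (cnj (\<sigma> (\<II> a) a)) (U (\<II> a) x))"
  by (simp add: symmetric_projective_rep_def)

lemma symmetric_projective_rep_linear:
  "symmetric_projective_rep \<II> \<sigma> smul form U \<Longrightarrow> Vector_Spaces.linear smul smul (U a)"
  by (simp add: symmetric_projective_rep_def projective_rep_def bounded_operator_def)

lemma similar_imp_fundamentally_reducible:
  assumes "krein_space smul form" and U: "symmetric_projective_rep \<II> \<sigma> smul form U"
    and "similar_to_hilbert_rep TYPE('g::ab_group_add) \<II> \<sigma> smul form U"
  shows "fundamentally_reducible smul form U"
proof -
  interpret K: krein_space smul form by fact
  obtain smulG :: "complex \<Rightarrow> 'g \<Rightarrow> 'g" and ipG T where "hilbert_space smulG ipG"
    and T: "symmetric_projective_rep \<II> \<sigma> smulG ipG T"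
    and "similar_reps smul form U smulG ipG T"
    using assms(3) unfolding similar_to_hilbert_rep_def by blast
  then obtain \<Phi> where \<Phi>: "bounded_operator smul form smulG ipG \<Phi>" "bij \<Phi>"
      "bounded_operator smulG ipG smul form (inv \<Phi>)" "\<And>a. T a \<circ> \<Phi> = \<Phi> \<circ> U a"
    unfolding similar_reps_def by blast
  interpret G: hilbert_space smulG ipG by fact
  interpret \<Phi>: Vector_Spaces.linear smul smulG \<Phi>
    using \<Phi>(1) by (simp add: bounded_operator_def)
  obtain ip J C where p: "fundamental_pair smul form ip J"
    and C: "\<And>x. G.N (\<Phi> x) \<le> C * form_norm ip x"
    using \<Phi>(1) G.fundamental_pair_unique(1) unfolding bounded_operator_def by metis
  obtain ip2 J2 D where p2: "fundamental_pair smul form ip2 J2"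
    and D: "\<And>y. form_norm ip2 (inv \<Phi> y) \<le> D * G.N y"
    using \<Phi>(3) G.fundamental_pair_unique(1) unfolding bounded_operator_def by metis
  \<comment> \<open>The bounds for the similarity and for its inverse come with unrelated inner
    products \<open>ip\<close> and \<open>ip2\<close>; this joins them.\<close>
  obtain E where E: "E > 0" "\<And>x. form_norm ip x \<le> E * form_norm ip2 x"
    using fundamental_pair_norm_bound[OF p2 p] by blast
  define b where "b x y = ipG (\<Phi> x) (\<Phi> y)" for x y
  have b_norm: "form_norm b x = G.N (\<Phi> x)" for x
    by (simp add: form_norm_def b_def)
  show ?thesis
  proof (rule fundamentally_reducibleI[OF p])
    show "hermitian_space smul form" ..
    show "hermitian_space smul b"
      by unfold_locales
         (simp_all add: b_def \<Phi>.add \<Phi>.scale G.form_simps, rule G.form_hermitian)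
    show "form_norm b x \<le> C * form_norm ip x" for x
      by (simp add: b_norm C)
    show "1 / (E * (\<bar>D\<bar> + 1)) > 0"
      using E(1) by (simp add: add_nonneg_pos)
    show "1 / (E * (\<bar>D\<bar> + 1)) * form_norm ip x \<le> form_norm b x" for x
    proof -
      have "form_norm ip2 x \<le> D * G.N (\<Phi> x)"
        using D[of "\<Phi> x"] \<Phi>(2) by (simp add: bij_is_inj)
      also have "\<dots> \<le> (\<bar>D\<bar> + 1) * G.N (\<Phi> x)"
        by (intro mult_right_mono) auto
      finally have "form_norm ip x \<le> E * ((\<bar>D\<bar> + 1) * G.N (\<Phi> x))"
        using E mult_left_mono order_trans by (meson less_imp_le)
      moreover have "E * (\<bar>D\<bar> + 1) > 0"
        using E(1) by (simp add: add_nonneg_pos)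
      ultimately show ?thesis
        by (simp add: b_norm pos_divide_le_eq mult_ac)
    qed
    show "Vector_Spaces.linear smul smul (U a)" for a
      using U by (rule symmetric_projective_rep_linear)
    show "is_form_adjoint form (U a) (\<lambda>x. smul (cnj (\<sigma> (\<II> a) a)) (U (\<II> a) x))" for a
      using U by (rule symmetric_projective_rep_adjoint)
    have T_\<Phi>: "T a (\<Phi> x) = \<Phi> (U a x)" for a x
      using \<Phi>(4)[of a] by (metis comp_apply)
    show "is_form_adjoint b (U a) (\<lambda>x. smul (cnj (\<sigma> (\<II> a) a)) (U (\<II> a) x))" for a
      using symmetric_projective_rep_adjoint[OF T, of a]
      by (simp add: is_form_adjoint_def b_def \<Phi>.scale flip: T_\<Phi>)
  qed
qed

lemma fundamentally_reducible_imp_similar: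
  fixes smul :: "complex \<Rightarrow> 'k::ab_group_add \<Rightarrow> 'k"
  assumes U: "symmetric_projective_rep \<II> \<sigma> smul form U"
    and "fundamentally_reducible smul form U"
  shows "similar_to_hilbert_rep TYPE('k) \<II> \<sigma> smul form U"
proof -
  obtain ip J where p: "fundamental_pair smul form ip J" and "\<And>a. U a \<circ> J = J \<circ> U a"
    using assms(2) unfolding fundamentally_reducible_def fundamental_symmetry_def by blast
  then have UJ: "U a (J x) = J (U a x)" for a x
    by (metis comp_apply)
  interpret H: hilbert_space smul ip
    using p by (rule fundamental_pair_hilbert_space)
  have ip: "ip x y = form (J x) y" for x y
    by (simp add: fundamental_pair_form[OF p] fundamental_pair_involution[OF p])
  \<comment> \<open>On the new Hilbert space only the norm of \<open>ip\<close> counts, while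
    boundedness for \<open>form\<close> may use two other norms; hence the detour through
    \<open>D\<close> and \<open>E\<close>.\<close>
  have "bounded_operator smul ip smul ip (U a)" for a
  proof -
    obtain ip1 J1 ip2 J2 C where p1: "fundamental_pair smul form ip1 J1"
      and p2: "fundamental_pair smul form ip2 J2"
      and C: "\<And>x. form_norm ip2 (U a x) \<le> C * form_norm ip1 x"
      using U unfolding symmetric_projective_rep_def projective_rep_def bounded_operator_def
      by metis
    obtain D where D: "D > 0" "\<And>x. form_norm ip1 x \<le> D * form_norm ip x"
      using fundamental_pair_norm_bound[OF p p1] by blast
    obtain E where E: "E > 0" "\<And>x. form_norm ip x \<le> E * form_norm ip2 x"
      using fundamental_pair_norm_bound[OF p2 p] by blast
    interpret H1: hilbert_space smul ip1
      using p1 by (rule fundamental_pair_hilbert_space)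
    have "form_norm ip (U a x) \<le> (E * \<bar>C\<bar> * D) * form_norm ip x" for x
    proof -
      have "form_norm ip (U a x) \<le> E * form_norm ip2 (U a x)" by (rule E)
      also have "form_norm ip2 (U a x) \<le> \<bar>C\<bar> * H1.N x"
        using C[of x] mult_right_mono[OF abs_ge_self H1.N_nonneg] order_trans by blast
      also have "H1.N x \<le> D * form_norm ip x" by (rule D)
      finally show ?thesis
        using E(1) by (simp add: mult_left_mono mult.assoc)
    qed
    then show ?thesis
      using symmetric_projective_rep_linear[OF U] H.fundamental_pair_id
      unfolding bounded_operator_def by blast
  qed
  \<comment> \<open>As \<open>J\<close> passes through \<open>U a\<close>, the adjoint relation for
    \<open>form\<close> at \<open>J x\<close> is the one for \<open>ip\<close> at
    \<open>x\<close>.\<close>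
  moreover have "is_form_adjoint ip (U a) (\<lambda>x. smul (cnj (\<sigma> (\<II> a) a)) (U (\<II> a) x))" for a
    using symmetric_projective_rep_adjoint[OF U, of a]
    by (simp add: is_form_adjoint_def ip flip: UJ)
  ultimately have "symmetric_projective_rep \<II> \<sigma> smul ip U"
    using U unfolding symmetric_projective_rep_def projective_rep_def by blast
  moreover have "similar_reps smul form U smul ip U"
    unfolding similar_reps_def
  proof (intro exI[of _ id] conjI)
    have "\<exists>C. \<forall>x. form_norm ip (id x) \<le> C * form_norm ip x"
      by (rule exI[of _ 1]) simp
    then show "bounded_operator smul form smul ip id" "bounded_operator smul ip smul form (inv id)"
      using p H.fundamental_pair_id H.linear_id unfolding bounded_operator_def inv_id by blast+
  qed auto
  ultimately show ?thesis
    unfolding similar_to_hilbert_rep_def using H.hilbert_space_axioms by blast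
qed

text \<open>Reducibility yields a Hilbert space on the same vector space, so the type
  \<open>'k\<close> suffices for the equivalence. The second conjunct admits similar representations
  on a Hilbert space of any other type.\<close>

theorem proposition4p1:
  fixes \<II> :: "'s::semigroup_mult \<Rightarrow> 's"
    and \<sigma> :: "'s \<Rightarrow> 's \<Rightarrow> complex"
    and smul :: "complex \<Rightarrow> 'k::ab_group_add \<Rightarrow> 'k"
    and form :: "'k \<Rightarrow> 'k \<Rightarrow> complex"
    and U :: "'s \<Rightarrow> 'k \<Rightarrow> 'k"
  assumes "semigroup_involution \<II>"
    and "two_cocycle \<sigma>"
    and "krein_space smul form"
    and "symmetric_projective_rep \<II> \<sigma> smul form U"
  shows "(similar_to_hilbert_rep TYPE('k) \<II> \<sigma> smul form U
            \<longleftrightarrow> fundamentally_reducible smul form U) \<and>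
         (similar_to_hilbert_rep TYPE('g::ab_group_add) \<II> \<sigma> smul form U
            \<longrightarrow> fundamentally_reducible smul form U)"
  using similar_imp_fundamentally_reducible[OF assms(3,4), where 'g = 'k]
    similar_imp_fundamentally_reducible[OF assms(3,4), where 'g = 'g]
    fundamentally_reducible_imp_similar[OF assms(4)]
  by blast

end
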